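(* Let $H$ be a finite-dimensional Hilbert space, regarded as a 1-cell $\mathbf{Hilb}\to\mathbf{Hilb}$ in $\mathbf{2Hilb}$, and let $n$ be a natural number. Controlled operations on $H$ indexed by the object $\mathbf{Hilb}^n$, that is, 2-cells $W_R;H\Rightarrow W_R;H$ in $\mathbf{2Hilb}$, correspond bijectively to $n$-tuples $(f_1,\ldots,f_n)$ of linear endomorphisms of $H$, chosen independently, the tuple being the list of entries of the 2-cell.
   Context: $\mathbf{2Hilb}$ is the 2-category of finite-dimensional 2-Hilbert spaces in matrix form: objects are $\mathbf{Hilb}^n$, $n\in\mathbb{N}$; a 1-cell $\mathbf{Hilb}^n\to\mathbf{Hilb}^m$ is an $m\times n$ matrix of finite-dimensional Hilbert spaces, composed by matrix multiplication with $\oplus$ and $\otimes$; a 2-cell $F\Rightarrow G$ is a matrix of linear maps $F_{i,j}\to G_{i,j}$, composed vertically entrywise. $X;Y$ denotes "first $X$, then $Y$"; coherence isomorphisms (such as $\mathbb{C}\otimes H\cong H$) are suppressed. The canonical witness of $\mathbf{Hilb}^n$ has as one of its 1-cells $W_R:\mathbf{Hilb}^n\to\mathbf{Hilb}$, the row matrix with $n$ entries $\mathbb{C}$. A controlled operation on $H$ indexed by $\mathbf{Hilb}^n$ is an arbitrary 2-cell $W_R;H\Rightarrow W_R;H$ (the composite $W_R;H$ is, up to isomorphism, the matrix with $n$ entries all equal to $H$). *)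

theory Defs
  imports Complex_Main "HOL-Library.FuncSet" "Jordan_Normal_Form.VS_Connect"
begin

text \<open>Hilbert spaces are carrier-based, so that one matrix can have entries of different
  dimensions. The multiplicative fields which the record \<open>module\<close> inherits from \<open>ring\<close> carry no
  meaning. Inner products are antilinear in the first argument. A finite-dimensional inner product
  space is complete, so completeness is not a separate axiom.\<close>

record 'a hilbert_space = "(complex, 'a) module" +
  ip :: "'a \<Rightarrow> 'a \<Rightarrow> complex"

locale fd_hilbert_space = vectorspace class_ring H for H :: "'a hilbert_space" +
  assumes finite_dimensional: fin_dim
    and ip_add: "\<lbrakk>x \<in> carrier H; y \<in> carrier H; z \<in> carrier H\<rbrakk>
      \<Longrightarrow> ip H x (y \<oplus>\<^bsub>H\<^esub> z) = ip H x y + ip H x z"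
    and ip_smult: "\<lbrakk>x \<in> carrier H; y \<in> carrier H\<rbrakk> \<Longrightarrow> ip H x (c \<odot>\<^bsub>H\<^esub> y) = c * ip H x y"
    and ip_cnj: "\<lbrakk>x \<in> carrier H; y \<in> carrier H\<rbrakk> \<Longrightarrow> ip H x y = cnj (ip H y x)"
    and ip_pos: "\<lbrakk>x \<in> carrier H; x \<noteq> \<zero>\<^bsub>H\<^esub>\<rbrakk> \<Longrightarrow> 0 < Re (ip H x x)"

text \<open>Restricting to extensional functions makes equality of linear maps as HOL functions coincide
  with equality on the carrier.\<close>

definition linear_maps :: "'a hilbert_space \<Rightarrow> 'b hilbert_space \<Rightarrow> ('a \<Rightarrow> 'b) set" where
  "linear_maps H K = LinearCombinations.module_hom class_ring H K \<inter> extensional (carrier H)"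

definition complex_space :: "complex hilbert_space" where
  "complex_space = \<lparr>carrier = UNIV, mult = undefined, one = undefined, zero = 0, add = (+),
     smult = (*), ip = (\<lambda>w z. cnj w * z)\<rparr>"

text \<open>The direct sum of \<open>V 0, \<dots>, V (p - 1)\<close>.\<close>

definition direct_sum :: "nat \<Rightarrow> (nat \<Rightarrow> 'a hilbert_space) \<Rightarrow> (nat \<Rightarrow> 'a) hilbert_space" where
  "direct_sum p V = \<lparr>carrier = (\<Pi>\<^sub>E k\<in>{..<p}. carrier (V k)), mult = undefined, one = undefined,
     zero = (\<lambda>k\<in>{..<p}. \<zero>\<^bsub>V k\<^esub>), add = (\<lambda>v w. \<lambda>k\<in>{..<p}. v k \<oplus>\<^bsub>V k\<^esub> w k),
     smult = (\<lambda>c v. \<lambda>k\<in>{..<p}. c \<odot>\<^bsub>V k\<^esub> v k), ip = (\<lambda>v w. \<Sum>k<p. ip (V k) (v k) (w k))\<rparr>"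

text \<open>The tensor product is built as in Reed and Simon, Methods of Modern Mathematical Physics I,
  Section II.4: \<open>x \<otimes> y\<close> is the form \<open>(u, v) \<mapsto> \<langle>u, x\<rangle> \<langle>v, y\<rangle>\<close>, antilinear in both arguments, the
  tensor product is the linear span of these forms, and its inner product is the sesquilinear
  extension of \<open>\<langle>x \<otimes> y, x' \<otimes> y'\<rangle> = \<langle>x, x'\<rangle> \<langle>y, y'\<rangle>\<close>. No completion is needed in finite dimension.
  Forms are set to 0 outside the carriers.\<close>

definition elem_tensor ::
    "'a hilbert_space \<Rightarrow> 'b hilbert_space \<Rightarrow> 'a \<Rightarrow> 'b \<Rightarrow> 'a \<Rightarrow> 'b \<Rightarrow> complex" where
  "elem_tensor H K x y =
     (\<lambda>u v. if u \<in> carrier H \<and> v \<in> carrier K then ip H u x * ip K v y else 0)"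

text \<open>Scalars need not appear in a sum of elementary tensors, as they can be absorbed into the
  first factors.\<close>

definition tensor_repr ::
    "'a hilbert_space \<Rightarrow> 'b hilbert_space \<Rightarrow> ('a \<Rightarrow> 'b \<Rightarrow> complex) \<Rightarrow> ('a \<times> 'b) list \<Rightarrow> bool" where
  "tensor_repr H K T ps \<longleftrightarrow> set ps \<subseteq> carrier H \<times> carrier K \<and>
     T = (\<lambda>u v. \<Sum>(x, y)\<leftarrow>ps. elem_tensor H K x y u v)"

definition tensor ::
    "'a hilbert_space \<Rightarrow> 'b hilbert_space \<Rightarrow> ('a \<Rightarrow> 'b \<Rightarrow> complex) hilbert_space" where
  "tensor H K = \<lparr>carrier = {T. \<exists>ps. tensor_repr H K T ps}, mult = undefined, one = undefined,
     zero = (\<lambda>u v. 0), add = (\<lambda>S T u v. S u v + T u v), smult = (\<lambda>c T u v. c * T u v),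
     ip = (\<lambda>S T. THE z. \<exists>ps qs. tensor_repr H K S ps \<and> tensor_repr H K T qs \<and>
       z = (\<Sum>(x, y)\<leftarrow>ps. \<Sum>(x', y')\<leftarrow>qs. ip H x x' * ip K y y'))\<rparr>"

text \<open>The object \<open>Hilb\<^sup>n\<close> of 2Hilb is represented by \<open>n\<close>. Matrix indices start at 0.\<close>

definition one_cells :: "nat \<Rightarrow> nat \<Rightarrow> 'a hilbert_space mat set" where
  "one_cells n m = {F \<in> carrier_mat m n. \<forall>i<m. \<forall>j<n. fd_hilbert_space (F $$ (i, j))}"

text \<open>\<open>F ;; G\<close> is first \<open>F\<close>, then \<open>G\<close>, that is, the matrix product of \<open>G\<close> and \<open>F\<close>.\<close>

definition comp_one_cells ::
    "'a hilbert_space mat \<Rightarrow> 'b hilbert_space mat \<Rightarrow> (nat \<Rightarrow> 'b \<Rightarrow> 'a \<Rightarrow> complex) hilbert_space mat"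
    (infixl \<open>;;\<close> 70) where
  "F ;; G = mat (dim_row G) (dim_col F)
     (\<lambda>(i, j). direct_sum (dim_row F) (\<lambda>k. tensor (G $$ (i, k)) (F $$ (k, j))))"

text \<open>The 2-cells between two parallel 1-cells from \<open>Hilb\<^sup>n\<close> to \<open>Hilb\<^sup>m\<close>; there are none
  unless \<open>F\<close> and \<open>G\<close> are such 1-cells.\<close>

definition two_cells ::
    "nat \<Rightarrow> nat \<Rightarrow> 'a hilbert_space mat \<Rightarrow> 'b hilbert_space mat \<Rightarrow> ('a \<Rightarrow> 'b) mat set" where
  "two_cells n m F G = {\<alpha> \<in> carrier_mat m n. F \<in> one_cells n m \<and> G \<in> one_cells n m \<and>
     (\<forall>i<m. \<forall>j<n. \<alpha> $$ (i, j) \<in> linear_maps (F $$ (i, j)) (G $$ (i, j)))}"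

definition witness_row :: "nat \<Rightarrow> complex hilbert_space mat" where
  "witness_row n = mat 1 n (\<lambda>_. complex_space)"

definition space_one_cell :: "'a hilbert_space \<Rightarrow> 'a hilbert_space mat" where
  "space_one_cell H = mat 1 1 (\<lambda>_. H)"

definition controlled_operations ::
    "nat \<Rightarrow> 'a hilbert_space
      \<Rightarrow> ((nat \<Rightarrow> 'a \<Rightarrow> complex \<Rightarrow> complex) \<Rightarrow> (nat \<Rightarrow> 'a \<Rightarrow> complex \<Rightarrow> complex)) mat set" where
  "controlled_operations n H =
     two_cells n 1 (witness_row n ;; space_one_cell H) (witness_row n ;; space_one_cell H)"

text \<open>Every entry of \<open>witness_row n ;; space_one_cell H\<close> is the one-summand direct sum of
  \<open>H \<otimes> \<complex>\<close>. The coherence isomorphism from it to \<open>H\<close> sends \<open>x \<otimes> z\<close> to \<open>z x\<close>.\<close>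

definition unit_sum :: "'a hilbert_space \<Rightarrow> (nat \<Rightarrow> 'a \<Rightarrow> complex \<Rightarrow> complex) hilbert_space" where
  "unit_sum H = direct_sum 1 (\<lambda>_. tensor H complex_space)"

definition coherence :: "'a hilbert_space \<Rightarrow> (nat \<Rightarrow> 'a \<Rightarrow> complex \<Rightarrow> complex) \<Rightarrow> 'a" where
  "coherence H = (THE \<kappa>. \<kappa> \<in> linear_maps (unit_sum H) H \<and>
     (\<forall>x\<in>carrier H. \<forall>z. \<kappa> (\<lambda>k\<in>{..<1}. elem_tensor H complex_space x z) = z \<odot>\<^bsub>H\<^esub> x))"

definition transport ::
    "'a hilbert_space \<Rightarrow> ((nat \<Rightarrow> 'a \<Rightarrow> complex \<Rightarrow> complex) \<Rightarrow> (nat \<Rightarrow> 'a \<Rightarrow> complex \<Rightarrow> complex))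
      \<Rightarrow> 'a \<Rightarrow> 'a" where
  "transport H f =
     (\<lambda>x\<in>carrier H. coherence H (f (inv_into (carrier (unit_sum H)) (coherence H) x)))"

text \<open>The list of entries of a controlled operation, each read as an endomorphism of \<open>H\<close> along the
  coherence isomorphism.\<close>

definition entry_list ::
    "nat \<Rightarrow> 'a hilbert_space
      \<Rightarrow> ((nat \<Rightarrow> 'a \<Rightarrow> complex \<Rightarrow> complex) \<Rightarrow> (nat \<Rightarrow> 'a \<Rightarrow> complex \<Rightarrow> complex)) mat
      \<Rightarrow> ('a \<Rightarrow> 'a) list" where
  "entry_list n H \<alpha> = map (\<lambda>j. transport H (\<alpha> $$ (0, j))) [0..<n]"

end

theory Submission
  imports Defs
begin

text \<open>Every entry of the composite \<open>witness_row n ;; space_one_cell H\<close> is the same space, the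
  one-summand direct sum of \<open>H \<otimes> \<complex>\<close>. A 2-cell from this composite to itself is therefore just a
  choice of \<open>n\<close> independent linear endomorphisms of that space, since a matrix of linear maps is
  subject to no condition relating its entries. What has to be shown is that reading these
  endomorphisms along the coherence isomorphism yields exactly the endomorphisms of \<open>H\<close>, each once.

  The point that carries this is that \<open>x \<mapsto> x \<otimes> 1\<close> is an isometric isomorphism from \<open>H\<close> onto the
  entry (\<open>unit_embedding_bij\<close> and the lemmas after it). It is onto because a sum of elementary
  tensors \<open>\<Sum> x\<^sub>i \<otimes> z\<^sub>i\<close> collapses to \<open>(\<Sum> z\<^sub>i x\<^sub>i) \<otimes> 1\<close>, and injective because an inner product is
  nondegenerate. Two consequences follow. The entry inherits the axioms of a finite-dimensional
  Hilbert space from \<open>H\<close>, so the composite is a 1-cell and 2-cells on it can exist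
  (\<open>fd_hilbert_space_unit_sum\<close>). And the inverse of the isomorphism is the coherence map, so that
  \<open>transport\<close> is conjugation by an isomorphism (\<open>bij_betw_transport\<close>).\<close>

section \<open>Inner products\<close>

context fd_hilbert_space
begin

lemma smult_complex:
  assumes "x \<in> carrier H"
  shows "(a * b) \<odot>\<^bsub>H\<^esub> x = a \<odot>\<^bsub>H\<^esub> (b \<odot>\<^bsub>H\<^esub> x)"
    and "(a + b) \<odot>\<^bsub>H\<^esub> x = a \<odot>\<^bsub>H\<^esub> x \<oplus>\<^bsub>H\<^esub> b \<odot>\<^bsub>H\<^esub> x"
    and "1 \<odot>\<^bsub>H\<^esub> x = x"
  using smult_assoc1[of a b x] smult_l_distr[of a b x] smult_one[of x] assms by simp_all

lemma ip_zero_right: "x \<in> carrier H \<Longrightarrow> ip H x \<zero>\<^bsub>H\<^esub> = 0"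
  using ip_smult[of x "\<zero>\<^bsub>H\<^esub>" 0] by simp

lemma ip_add_left:
  assumes "x \<in> carrier H" "y \<in> carrier H" "z \<in> carrier H"
  shows "ip H (x \<oplus>\<^bsub>H\<^esub> y) z = ip H x z + ip H y z"
  using assms ip_cnj[of "x \<oplus>\<^bsub>H\<^esub> y" z] ip_cnj[of x z] ip_cnj[of y z]
  by (simp add: ip_add)

lemma ip_smult_left:
  assumes "x \<in> carrier H" "y \<in> carrier H"
  shows "ip H (c \<odot>\<^bsub>H\<^esub> x) y = cnj c * ip H x y"
  using assms ip_cnj[of "c \<odot>\<^bsub>H\<^esub> x" y] ip_cnj[of x y] by (simp add: ip_smult)

lemma ip_zero_left: "x \<in> carrier H \<Longrightarrow> ip H \<zero>\<^bsub>H\<^esub> x = 0"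
  using ip_smult_left[of "\<zero>\<^bsub>H\<^esub>" x 0] by simp

text \<open>Test the hypothesis on the difference \<open>x - y\<close> itself, which then has norm 0.\<close>

lemma ip_nondegenerate:
  assumes x: "x \<in> carrier H" and y: "y \<in> carrier H"
    and eq: "\<And>u. u \<in> carrier H \<Longrightarrow> ip H u x = ip H u y"
  shows "x = y"
proof -
  define d where "d = x \<oplus>\<^bsub>H\<^esub> (-1) \<odot>\<^bsub>H\<^esub> y"
  have d: "d \<in> carrier H"
    using x y by (simp add: d_def)
  have "ip H d d = ip H d x - ip H d y"
    using x y d by (subst (2) d_def) (simp add: ip_add ip_smult)
  then have "d = \<zero>\<^bsub>H\<^esub>"
    using ip_pos[OF d] eq[OF d] by auto
  moreover have "(-1) \<odot>\<^bsub>H\<^esub> y = \<ominus>\<^bsub>H\<^esub> y"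
    using smult_minus_1[OF y] by (simp add: class_ring_simps)
  ultimately have "\<ominus>\<^bsub>H\<^esub> (\<ominus>\<^bsub>H\<^esub> y) = x"
    using x y by (intro M.minus_equality) (auto simp: d_def)
  then show ?thesis using y by simp
qed

end

text \<open>Nothing is known about \<open>K\<close> beforehand; every axiom is pulled back to \<open>H\<close> along the bijection.
  Once \<open>K\<close> is a vector space, \<open>\<phi>\<close> is a surjective linear map, and such maps carry a finite
  generating set to one of the target.\<close>

lemma fd_hilbert_space_isometric_image:
  assumes H: "fd_hilbert_space H" and bij: "bij_betw \<phi> (carrier H) (carrier K)"
    and zero: "\<phi> \<zero>\<^bsub>H\<^esub> = \<zero>\<^bsub>K\<^esub>"
    and add: "\<And>x y. \<lbrakk>x \<in> carrier H; y \<in> carrier H\<rbrakk> \<Longrightarrow> \<phi> (x \<oplus>\<^bsub>H\<^esub> y) = \<phi> x \<oplus>\<^bsub>K\<^esub> \<phi> y"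
    and smult: "\<And>c x. x \<in> carrier H \<Longrightarrow> \<phi> (c \<odot>\<^bsub>H\<^esub> x) = c \<odot>\<^bsub>K\<^esub> \<phi> x"
    and ip: "\<And>x y. \<lbrakk>x \<in> carrier H; y \<in> carrier H\<rbrakk> \<Longrightarrow> ip K (\<phi> x) (\<phi> y) = ip H x y"
  shows "fd_hilbert_space K"
proof -
  interpret H: fd_hilbert_space H by (rule H)
  have K: "carrier K = \<phi> ` carrier H"
    using bij by (simp add: bij_betw_def)
  note ops = zero[symmetric] add[symmetric] smult[symmetric]
  have vs: "vectorspace class_ring K"
  proof (rule vs_criteria)
    show "field (class_ring :: complex ring)" by (rule class_field)
    show "\<forall>v\<in>carrier K. \<exists>w\<in>carrier K. v \<oplus>\<^bsub>K\<^esub> w = \<zero>\<^bsub>K\<^esub>"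
    proof
      fix v assume "v \<in> carrier K"
      then obtain x where x: "x \<in> carrier H" "v = \<phi> x" by (auto simp: K)
      then have "v \<oplus>\<^bsub>K\<^esub> \<phi> (\<ominus>\<^bsub>H\<^esub> x) = \<zero>\<^bsub>K\<^esub>"
        by (simp add: ops H.M.r_neg)
      then show "\<exists>w\<in>carrier K. v \<oplus>\<^bsub>K\<^esub> w = \<zero>\<^bsub>K\<^esub>" using x by (auto simp: K)
    qed
  qed (auto simp: K ops H.M.add.m_ac H.smult_complex H.smult_r_distr)
  interpret K: vectorspace class_ring K by (rule vs)
  show ?thesis
  proof
    show "K.fin_dim"
    proof -
      interpret L: linear_map class_ring H K \<phi>
        by unfold_locales (use add smult K in \<open>auto simp: LinearCombinations.module_hom_def\<close>)
      show ?thesis using L.surj_fin_dim[OF H.finite_dimensional] K by simp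
    qed
    fix v assume "v \<in> carrier K"
    then obtain x where x: "x \<in> carrier H" "v = \<phi> x" by (auto simp: K)
    then show "0 < Re (ip K v v)" if "v \<noteq> \<zero>\<^bsub>K\<^esub>"
    proof -
      have "x \<noteq> \<zero>\<^bsub>H\<^esub>" using that x zero by blast
      with x show ?thesis using H.ip_pos ip by simp
    qed
    fix w assume "w \<in> carrier K"
    then obtain y where y: "y \<in> carrier H" "w = \<phi> y" by (auto simp: K)
    show "ip K v w = cnj (ip K w v)"
      unfolding x(2) y(2) ip[OF x(1) y(1)] ip[OF y(1) x(1)] by (rule H.ip_cnj[OF x(1) y(1)])
    show "ip K v (c \<odot>\<^bsub>K\<^esub> w) = c * ip K v w" for c
      unfolding x(2) y(2) smult[OF y(1), symmetric] using x(1) y(1) by (simp add: ip H.ip_smult)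
    fix w' assume "w' \<in> carrier K"
    then obtain y' where y': "y' \<in> carrier H" "w' = \<phi> y'" by (auto simp: K)
    show "ip K v (w \<oplus>\<^bsub>K\<^esub> w') = ip K v w + ip K v w'"
      unfolding x(2) y(2) y'(2) add[OF y(1) y'(1), symmetric]
      using x(1) y(1) y'(1) by (simp add: ip H.ip_add)
  qed
qed

section \<open>The right unit of the tensor product\<close>

text \<open>The image of \<open>\<Sum> x\<^sub>i \<otimes> z\<^sub>i\<close> under the isomorphism from \<open>H \<otimes> \<complex>\<close> to \<open>H\<close>, computed on a chosen
  representation by elementary tensors.\<close>

definition contract :: "'a hilbert_space \<Rightarrow> ('a \<times> complex) list \<Rightarrow> 'a" where
  "contract H ps = foldr (\<lambda>(x, z) s. z \<odot>\<^bsub>H\<^esub> x \<oplus>\<^bsub>H\<^esub> s) ps \<zero>\<^bsub>H\<^esub>"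

lemma carrier_complex_space [simp]: "carrier complex_space = UNIV"
  and ip_complex_space [simp]: "ip complex_space w z = cnj w * z"
  by (simp_all add: complex_space_def)

context fd_hilbert_space
begin

lemma contract_closed: "set ps \<subseteq> carrier H \<times> UNIV \<Longrightarrow> contract H ps \<in> carrier H"
  by (induction ps) (auto simp: contract_def)

lemma ip_contract_right:
  assumes "set ps \<subseteq> carrier H \<times> UNIV" "u \<in> carrier H"
  shows "ip H u (contract H ps) = (\<Sum>(x, z)\<leftarrow>ps. z * ip H u x)"
  using assms
proof (induction ps)
  case Nil
  then show ?case by (simp add: contract_def ip_zero_right)
next
  case (Cons p ps)
  then have "contract H ps \<in> carrier H" by (intro contract_closed) auto
  with Cons show ?case by (cases p) (auto simp: contract_def ip_add ip_smult)
qed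

lemma ip_contract_left:
  assumes "set ps \<subseteq> carrier H \<times> UNIV" "u \<in> carrier H"
  shows "ip H (contract H ps) u = (\<Sum>(x, z)\<leftarrow>ps. cnj z * ip H x u)"
  using assms
proof (induction ps)
  case Nil
  then show ?case by (simp add: contract_def ip_zero_left)
next
  case (Cons p ps)
  then have "contract H ps \<in> carrier H" by (intro contract_closed) auto
  with Cons show ?case by (cases p) (auto simp: contract_def ip_add_left ip_smult_left)
qed

lemma elem_tensor_move_scalar:
  assumes "x \<in> carrier H"
  shows "elem_tensor H complex_space x z = elem_tensor H complex_space (z \<odot>\<^bsub>H\<^esub> x) 1"
  using assms by (auto simp: elem_tensor_def fun_eq_iff ip_smult)

lemma tensor_repr_contract:
  assumes "tensor_repr H complex_space T ps"
  shows "contract H ps \<in> carrier H" "T = elem_tensor H complex_space (contract H ps) 1"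
proof -
  have ps: "set ps \<subseteq> carrier H \<times> UNIV"
    and T: "T = (\<lambda>u v. \<Sum>(x, z)\<leftarrow>ps. elem_tensor H complex_space x z u v)"
    using assms by (auto simp: tensor_repr_def)
  show "contract H ps \<in> carrier H" using ps by (rule contract_closed)
  show "T = elem_tensor H complex_space (contract H ps) 1"
  proof (intro ext)
    fix u v
    have "(\<Sum>(x, z)\<leftarrow>ps. elem_tensor H complex_space x z u v) =
        (if u \<in> carrier H then (\<Sum>(x, z)\<leftarrow>ps. z * ip H u x) * cnj v else 0)"
      by (induction ps) (auto simp: elem_tensor_def algebra_simps)
    then show "T u v = elem_tensor H complex_space (contract H ps) 1 u v"
      using ip_contract_right[OF ps] by (simp add: T elem_tensor_def)
  qed
qed

lemma tensor_repr_elem: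
  "x \<in> carrier H \<Longrightarrow> tensor_repr H complex_space (elem_tensor H complex_space x z) [(x, z)]"
  by (simp add: tensor_repr_def)

lemma elem_tensor_one_inj:
  assumes "x \<in> carrier H" "y \<in> carrier H"
    and eq: "elem_tensor H complex_space x 1 = elem_tensor H complex_space y 1"
  shows "x = y"
proof (rule ip_nondegenerate)
  fix u assume "u \<in> carrier H"
  \<comment> \<open>Evaluating the forms at \<open>(u, 1)\<close> recovers the inner products with \<open>u\<close>.\<close>
  then show "ip H u x = ip H u y"
    using fun_cong[OF fun_cong[OF eq], of u 1] by (simp add: elem_tensor_def)
qed (use assms in auto)

lemma carrier_tensor_complex:
  "carrier (tensor H complex_space) = (\<lambda>x. elem_tensor H complex_space x 1) ` carrier H"
proof (intro equalityI subsetI)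
  fix T assume "T \<in> carrier (tensor H complex_space)"
  then obtain ps where "tensor_repr H complex_space T ps" by (auto simp: tensor_def)
  from tensor_repr_contract[OF this]
  show "T \<in> (\<lambda>x. elem_tensor H complex_space x 1) ` carrier H" by blast
qed (auto simp: tensor_def intro: tensor_repr_elem)

text \<open>The inner product of a tensor product is given by a formula in a choice of representations.
  Contracting both representations turns the formula into the inner product of \<open>H\<close>, which shows
  that it does not depend on the choice.\<close>

lemma ip_tensor_complex:
  assumes x: "x \<in> carrier H" and y: "y \<in> carrier H"
  shows "ip (tensor H complex_space) (elem_tensor H complex_space x 1)
    (elem_tensor H complex_space y 1) = ip H x y"
proof -
  have formula: "(\<Sum>(x, y)\<leftarrow>ps. \<Sum>(x', y')\<leftarrow>qs. ip H x x' * ip complex_space y y') = ip H x y"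
    if ps: "tensor_repr H complex_space (elem_tensor H complex_space x 1) ps"
      and qs: "tensor_repr H complex_space (elem_tensor H complex_space y 1) qs" for ps qs
  proof -
    have sub: "set ps \<subseteq> carrier H \<times> UNIV" "set qs \<subseteq> carrier H \<times> UNIV"
      using ps qs by (auto simp: tensor_repr_def)
    have "x = contract H ps"
      by (rule elem_tensor_one_inj[OF x tensor_repr_contract[OF ps]])
    moreover have y_eq: "y = contract H qs"
      by (rule elem_tensor_one_inj[OF y tensor_repr_contract[OF qs]])
    ultimately have "ip H x y = (\<Sum>(x, z)\<leftarrow>ps. cnj z * ip H x y)"
      using ip_contract_left[OF sub(1) y] by simp
    also have "\<dots> = (\<Sum>(x, z)\<leftarrow>ps. \<Sum>(x', z')\<leftarrow>qs. ip H x x' * (cnj z * z'))"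
    proof (intro arg_cong[of _ _ sum_list] map_cong refl, clarify)
      fix a z assume "(a, z) \<in> set ps"
      then have "a \<in> carrier H" using sub by auto
      then have "ip H a y = (\<Sum>(x', z')\<leftarrow>qs. z' * ip H a x')"
        using ip_contract_right[OF sub(2)] y_eq by simp
      then show "cnj z * ip H a y = (\<Sum>(x', z')\<leftarrow>qs. ip H a x' * (cnj z * z'))"
        by (simp add: sum_list_const_mult[symmetric] case_prod_unfold mult_ac)
    qed
    finally show ?thesis by simp
  qed
  show ?thesis
    unfolding tensor_def hilbert_space.simps
  proof (rule the_equality)
    show "\<exists>ps qs. tensor_repr H complex_space (elem_tensor H complex_space x 1) ps \<and>
        tensor_repr H complex_space (elem_tensor H complex_space y 1) qs \<and>
        ip H x y = (\<Sum>(x, y)\<leftarrow>ps. \<Sum>(x', y')\<leftarrow>qs. ip H x x' * ip complex_space y y')"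
      by (intro exI conjI) (rule tensor_repr_elem[OF x] tensor_repr_elem[OF y]
          formula[symmetric, OF tensor_repr_elem[OF x] tensor_repr_elem[OF y]])+
  qed (use formula in auto)
qed

end

section \<open>The coherence isomorphism\<close>

definition unit_embedding :: "'a hilbert_space \<Rightarrow> 'a \<Rightarrow> nat \<Rightarrow> 'a \<Rightarrow> complex \<Rightarrow> complex" where
  "unit_embedding H x = (\<lambda>k\<in>{..<1}. elem_tensor H complex_space x 1)"

context fd_hilbert_space
begin

lemma unit_embedding_bij: "bij_betw (unit_embedding H) (carrier H) (carrier (unit_sum H))"
proof (rule bij_betw_imageI)
  show "inj_on (unit_embedding H) (carrier H)"
  proof (rule inj_onI)
    fix x y assume "x \<in> carrier H" "y \<in> carrier H" "unit_embedding H x = unit_embedding H y"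
    then show "x = y"
      using elem_tensor_one_inj by (auto simp: unit_embedding_def dest: fun_cong[of _ _ 0])
  qed
  show "unit_embedding H ` carrier H = carrier (unit_sum H)"
  proof (intro equalityI subsetI)
    fix w assume "w \<in> carrier (unit_sum H)"
    then have w: "w \<in> ({..<1} \<rightarrow>\<^sub>E carrier (tensor H complex_space))"
      by (simp add: unit_sum_def direct_sum_def)
    then obtain x where x: "x \<in> carrier H" "w 0 = elem_tensor H complex_space x 1"
      by (auto simp: carrier_tensor_complex PiE_iff)
    have "w = unit_embedding H x"
      using w x by (intro extensionalityI[of _ "{..<1}"]) (auto simp: unit_embedding_def PiE_iff)
    with x show "w \<in> unit_embedding H ` carrier H" by blast
  qed (auto simp: unit_sum_def direct_sum_def unit_embedding_def carrier_tensor_complex)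
qed

lemma unit_embedding_zero: "unit_embedding H \<zero>\<^bsub>H\<^esub> = \<zero>\<^bsub>unit_sum H\<^esub>"
  by (auto simp: unit_embedding_def unit_sum_def direct_sum_def tensor_def elem_tensor_def
      ip_zero_right fun_eq_iff)

lemma unit_embedding_add:
  "\<lbrakk>x \<in> carrier H; y \<in> carrier H\<rbrakk> \<Longrightarrow>
    unit_embedding H (x \<oplus>\<^bsub>H\<^esub> y) = unit_embedding H x \<oplus>\<^bsub>unit_sum H\<^esub> unit_embedding H y"
  by (auto simp: unit_embedding_def unit_sum_def direct_sum_def tensor_def elem_tensor_def
      ip_add fun_eq_iff algebra_simps)

lemma unit_embedding_smult:
  "x \<in> carrier H \<Longrightarrow> unit_embedding H (c \<odot>\<^bsub>H\<^esub> x) = c \<odot>\<^bsub>unit_sum H\<^esub> unit_embedding H x"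
  by (auto simp: unit_embedding_def unit_sum_def direct_sum_def tensor_def elem_tensor_def
      ip_smult fun_eq_iff)

lemma unit_embedding_ip:
  "\<lbrakk>x \<in> carrier H; y \<in> carrier H\<rbrakk> \<Longrightarrow>
    ip (unit_sum H) (unit_embedding H x) (unit_embedding H y) = ip H x y"
  by (simp add: unit_embedding_def unit_sum_def direct_sum_def ip_tensor_complex)

lemma unit_embedding_linear: "unit_embedding H \<in> LinearCombinations.module_hom class_ring H (unit_sum H)"
  using unit_embedding_bij
  by (auto simp: LinearCombinations.module_hom_def unit_embedding_add unit_embedding_smult
      dest: bij_betwE)

lemma fd_hilbert_space_unit_sum: "fd_hilbert_space (unit_sum H)"
  by (rule fd_hilbert_space_isometric_image[OF fd_hilbert_space_axioms unit_embedding_bij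
        unit_embedding_zero unit_embedding_add unit_embedding_smult unit_embedding_ip])

text \<open>Since the embedding is onto, a map with the defining property of the coherence map is
  determined by its values at the tensors \<open>x \<otimes> 1\<close>; hence it is the inverse of the embedding.\<close>

lemma coherence_eq:
  "coherence H = (\<lambda>w\<in>carrier (unit_sum H). inv_into (carrier H) (unit_embedding H) w)"
    (is "_ = ?\<kappa>")
  unfolding coherence_def
proof (rule the_equality)
  have inv: "?\<kappa> (unit_embedding H x) = x" if "x \<in> carrier H" for x
    using that unit_embedding_bij by (auto simp: bij_betw_def)
  have surj: "\<exists>x\<in>carrier H. w = unit_embedding H x" if "w \<in> carrier (unit_sum H)" for w
    using that unit_embedding_bij by (auto simp: bij_betw_def)
  have elem: "(\<lambda>k\<in>{..<1}. elem_tensor H complex_space x z) = unit_embedding H (z \<odot>\<^bsub>H\<^esub> x)"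
    if "x \<in> carrier H" for x z
    using elem_tensor_move_scalar[OF that] by (simp add: unit_embedding_def)
  have "?\<kappa> \<in> LinearCombinations.module_hom class_ring (unit_sum H) H"
    unfolding LinearCombinations.module_hom_def
  proof (clarsimp simp del: restrict_apply, intro conjI allI impI)
    show "?\<kappa> \<in> carrier (unit_sum H) \<rightarrow> carrier H"
      using surj inv by fastforce
    fix v w assume "v \<in> carrier (unit_sum H) \<and> w \<in> carrier (unit_sum H)"
    then obtain x y where "x \<in> carrier H" "v = unit_embedding H x"
      "y \<in> carrier H" "w = unit_embedding H y" using surj by metis
    then show "?\<kappa> (v \<oplus>\<^bsub>unit_sum H\<^esub> w) = ?\<kappa> v \<oplus>\<^bsub>H\<^esub> ?\<kappa> w"
      by (simp only: unit_embedding_add[symmetric] inv M.a_closed)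
  next
    fix c v assume "v \<in> carrier (unit_sum H)"
    then obtain x where "x \<in> carrier H" "v = unit_embedding H x" using surj by metis
    then show "?\<kappa> (c \<odot>\<^bsub>unit_sum H\<^esub> v) = c \<odot>\<^bsub>H\<^esub> ?\<kappa> v"
      using inv[of "c \<odot>\<^bsub>H\<^esub> x"] inv[of x] by (simp only: unit_embedding_smult[symmetric]) simp
  qed
  then show "?\<kappa> \<in> linear_maps (unit_sum H) H \<and>
      (\<forall>x\<in>carrier H. \<forall>z. ?\<kappa> (\<lambda>k\<in>{..<1}. elem_tensor H complex_space x z) = z \<odot>\<^bsub>H\<^esub> x)"
    using inv elem by (auto simp: linear_maps_def simp del: restrict_apply One_nat_def)
  fix \<kappa> assume \<kappa>: "\<kappa> \<in> linear_maps (unit_sum H) H \<and>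
      (\<forall>x\<in>carrier H. \<forall>z. \<kappa> (\<lambda>k\<in>{..<1}. elem_tensor H complex_space x z) = z \<odot>\<^bsub>H\<^esub> x)"
  show "\<kappa> = ?\<kappa>"
  proof (rule extensionalityI)
    show "\<kappa> \<in> extensional (carrier (unit_sum H))" using \<kappa> by (simp add: linear_maps_def)
    fix w assume "w \<in> carrier (unit_sum H)"
    then obtain x where x: "x \<in> carrier H" "w = unit_embedding H x" using surj by metis
    then have "\<kappa> w = 1 \<odot>\<^bsub>H\<^esub> x" using \<kappa> by (simp add: unit_embedding_def)
    also have "\<dots> = x" using x by (simp add: smult_complex)
    finally show "\<kappa> w = ?\<kappa> w" using inv x by simp
  qed simp
qed

end

section \<open>Endomorphisms and matrices\<close>

text \<open>Conjugation by an isomorphism is invertible because conjugation by its inverse undoes it. The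
  restrictions to the carriers keep the maps extensional.\<close>

lemma bij_betw_conjugate_linear_maps:
  assumes \<phi>: "\<phi> \<in> LinearCombinations.module_hom class_ring H K"
    and bij: "bij_betw \<phi> (carrier H) (carrier K)"
    and \<kappa>: "\<And>x. x \<in> carrier H \<Longrightarrow> \<kappa> (\<phi> x) = x"
    and H: "vectorspace class_ring H"
  shows "bij_betw (\<lambda>f. \<lambda>x\<in>carrier H. \<kappa> (f (\<phi> x))) (linear_maps K K) (linear_maps H H)"
proof -
  interpret H: vectorspace class_ring H by (rule H)
  have K: "carrier K = \<phi> ` carrier H" using bij by (simp add: bij_betw_def)
  have add: "\<phi> x \<oplus>\<^bsub>K\<^esub> \<phi> y = \<phi> (x \<oplus>\<^bsub>H\<^esub> y)" if "x \<in> carrier H" "y \<in> carrier H" for x y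
    using \<phi> that by (simp add: LinearCombinations.module_hom_def)
  have smult: "c \<odot>\<^bsub>K\<^esub> \<phi> x = \<phi> (c \<odot>\<^bsub>H\<^esub> x)" if "x \<in> carrier H" for c x
    using \<phi> that by (simp add: LinearCombinations.module_hom_def)
  have \<phi>\<kappa>: "\<kappa> v \<in> carrier H \<and> \<phi> (\<kappa> v) = v" if "v \<in> carrier K" for v
    using that \<kappa> by (auto simp: K)
  have \<kappa>_add: "\<kappa> (v \<oplus>\<^bsub>K\<^esub> w) = \<kappa> v \<oplus>\<^bsub>H\<^esub> \<kappa> w" if "v \<in> carrier K" "w \<in> carrier K" for v w
    using that \<kappa> by (auto simp: K add)
  have \<kappa>_smult: "\<kappa> (c \<odot>\<^bsub>K\<^esub> v) = c \<odot>\<^bsub>H\<^esub> \<kappa> v" if "v \<in> carrier K" for c v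
    using that \<kappa> by (auto simp: K smult)
  have closed: "\<phi> x \<in> carrier K" if "x \<in> carrier H" for x using that by (simp add: K)
  have K_add: "v \<oplus>\<^bsub>K\<^esub> w \<in> carrier K" if "v \<in> carrier K" "w \<in> carrier K" for v w
    using that by (auto simp: K add)
  have K_smult: "c \<odot>\<^bsub>K\<^esub> v \<in> carrier K" if "v \<in> carrier K" for c v
    using that H.smult_closed by (auto simp: K smult)
  show ?thesis
  proof (rule bij_betw_byWitness[where f' = "\<lambda>g. \<lambda>v\<in>carrier K. \<phi> (g (\<kappa> v))"])
    show "\<forall>f\<in>linear_maps K K.
        (\<lambda>v\<in>carrier K. \<phi> ((\<lambda>x\<in>carrier H. \<kappa> (f (\<phi> x))) (\<kappa> v))) = f"
      by (auto simp: linear_maps_def LinearCombinations.module_hom_def \<phi>\<kappa> Pi_iff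
          intro!: extensionalityI[of _ "carrier K"])
    show "\<forall>g\<in>linear_maps H H.
        (\<lambda>x\<in>carrier H. \<kappa> ((\<lambda>v\<in>carrier K. \<phi> (g (\<kappa> v))) (\<phi> x))) = g"
      by (auto simp: linear_maps_def LinearCombinations.module_hom_def \<kappa> closed Pi_iff
          intro!: extensionalityI[of _ "carrier H"])
    show "(\<lambda>f. \<lambda>x\<in>carrier H. \<kappa> (f (\<phi> x))) ` linear_maps K K \<subseteq> linear_maps H H"
      using H.smult_closed
      by (auto simp: linear_maps_def LinearCombinations.module_hom_def closed Pi_iff \<phi>\<kappa>
          add[symmetric] smult[symmetric] \<kappa>_add \<kappa>_smult)
    show "(\<lambda>g. \<lambda>v\<in>carrier K. \<phi> (g (\<kappa> v))) ` linear_maps H H \<subseteq> linear_maps K K"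
      by (auto simp: linear_maps_def LinearCombinations.module_hom_def closed Pi_iff \<phi>\<kappa>
          K_add K_smult add smult \<kappa>_add \<kappa>_smult)
  qed
qed

text \<open>\<open>transport\<close> is defined with a chosen preimage under the coherence map. On \<open>H\<close> this choice is
  the embedding \<open>x \<mapsto> x \<otimes> 1\<close>, because the coherence map is injective.\<close>

lemma (in fd_hilbert_space) bij_betw_transport:
  "bij_betw (transport H) (linear_maps (unit_sum H) (unit_sum H)) (linear_maps H H)"
proof -
  have coh: "coherence H (unit_embedding H x) = x" if "x \<in> carrier H" for x
    using that unit_embedding_bij by (auto simp: coherence_eq bij_betw_def)
  have "bij_betw (inv_into (carrier H) (unit_embedding H)) (carrier (unit_sum H)) (carrier H)"
    using unit_embedding_bij by (rule bij_betw_inv_into)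
  then have coh_inj: "inj_on (coherence H) (carrier (unit_sum H))"
    by (simp add: coherence_eq bij_betw_def)
  have "inv_into (carrier (unit_sum H)) (coherence H) x = unit_embedding H x"
    if "x \<in> carrier H" for x
    using that coh unit_embedding_bij by (intro inv_into_f_eq[OF coh_inj]) (auto dest: bij_betwE)
  then have transport: "transport H = (\<lambda>f. \<lambda>x\<in>carrier H. coherence H (f (unit_embedding H x)))"
    by (intro ext) (simp add: transport_def restrict_def)
  show ?thesis
    unfolding transport using coh
    by (rule bij_betw_conjugate_linear_maps[OF unit_embedding_linear unit_embedding_bij _
          vectorspace_axioms])
qed

text \<open>The entries of a row matrix can be chosen independently, so a bijection between the sets of
  admissible entries may be applied entry by entry.\<close>

lemma bij_betw_row_matrix_to_list:
  assumes t: "bij_betw t A B"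
  shows "bij_betw (\<lambda>M. map (\<lambda>j. t (M $$ (0, j))) [0..<n])
    {M \<in> carrier_mat 1 n. \<forall>j<n. M $$ (0, j) \<in> A} {xs. length xs = n \<and> set xs \<subseteq> B}"
proof (rule bij_betw_byWitness[where f' = "\<lambda>xs. mat 1 n (\<lambda>(i, j). inv_into A t (xs ! j))"])
  show "\<forall>M\<in>{M \<in> carrier_mat 1 n. \<forall>j<n. M $$ (0, j) \<in> A}.
      mat 1 n (\<lambda>(i, j). inv_into A t (map (\<lambda>j. t (M $$ (0, j))) [0..<n] ! j)) = M"
    using t by (auto intro!: eq_matI simp: bij_betw_def)
  show "\<forall>xs\<in>{xs. length xs = n \<and> set xs \<subseteq> B}.
      map (\<lambda>j. t (mat 1 n (\<lambda>(i, j). inv_into A t (xs ! j)) $$ (0, j))) [0..<n] = xs"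
    using t by (auto intro!: nth_equalityI simp: bij_betw_inv_into_right subset_iff)
  show "(\<lambda>M. map (\<lambda>j. t (M $$ (0, j))) [0..<n]) ` {M \<in> carrier_mat 1 n. \<forall>j<n. M $$ (0, j) \<in> A}
      \<subseteq> {xs. length xs = n \<and> set xs \<subseteq> B}"
    using bij_betwE[OF t] by auto
  show "(\<lambda>xs. mat 1 n (\<lambda>(i, j). inv_into A t (xs ! j))) ` {xs. length xs = n \<and> set xs \<subseteq> B}
      \<subseteq> {M \<in> carrier_mat 1 n. \<forall>j<n. M $$ (0, j) \<in> A}"
    using bij_betwE[OF bij_betw_inv_into[OF t]] by (auto simp: subset_iff)
qed

lemma direct_sum_cong:
  assumes "\<And>k. k < p \<Longrightarrow> V k = W k"
  shows "direct_sum p V = direct_sum p W"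
proof -
  have "(\<Pi>\<^sub>E k\<in>{..<p}. carrier (V k)) = (\<Pi>\<^sub>E k\<in>{..<p}. carrier (W k))"
    by (rule PiE_cong) (simp add: assms)
  then show ?thesis
    by (simp add: direct_sum_def assms restrict_def fun_eq_iff)
qed

lemma witness_row_comp_entry:
  assumes "j < n"
  shows "(witness_row n ;; space_one_cell H) $$ (0, j) = unit_sum H"
  using assms
  by (auto simp: comp_one_cells_def witness_row_def space_one_cell_def unit_sum_def
      intro!: direct_sum_cong)

lemma (in fd_hilbert_space) controlled_operations_eq:
  "controlled_operations n H = {\<alpha> \<in> carrier_mat 1 n.
     \<forall>j<n. \<alpha> $$ (0, j) \<in> linear_maps (unit_sum H) (unit_sum H)}"
proof -
  have "witness_row n ;; space_one_cell H \<in> carrier_mat 1 n"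
    by (simp add: comp_one_cells_def witness_row_def space_one_cell_def)
  then have "witness_row n ;; space_one_cell H \<in> one_cells n 1"
    by (simp add: one_cells_def witness_row_comp_entry fd_hilbert_space_unit_sum)
  then show ?thesis
    by (auto simp: controlled_operations_def two_cells_def witness_row_comp_entry)
qed

theorem theorem3p6:
  fixes H :: "'a hilbert_space" and n :: nat
  assumes "fd_hilbert_space H"
  shows "bij_betw (entry_list n H) (controlled_operations n H)
    {fs. length fs = n \<and> set fs \<subseteq> linear_maps H H}"
proof -
  interpret fd_hilbert_space H by (rule assms)
  have "entry_list n H = (\<lambda>\<alpha>. map (\<lambda>j. transport H (\<alpha> $$ (0, j))) [0..<n])"
    by (simp add: entry_list_def fun_eq_iff)
  then show ?thesis
    unfolding controlled_operations_eq
    using bij_betw_row_matrix_to_list[OF bij_betw_transport] by simp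
qed

end
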